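(* Let $n\ge 2$ and let $\mathcal{C}$ be either $\mathcal{K}^n$ or $\mathcal{K}^n_o$. An operation $*:\mathcal{C}^2\to\mathcal{K}^n$ is projection covariant if and only if there is a nonempty closed convex set $M$ in $\mathbb{R}^4$ such that $$h_{K*L}(x)=h_M\big(h_K(-x),h_K(x),h_L(-x),h_L(x)\big)$$ for all $K,L\in\mathcal{C}$ and all $x\in\mathbb{R}^n$.
   Context: $\mathcal{K}^n$ is the class of nonempty compact convex subsets of $\mathbb{R}^n$; $\mathcal{K}^n_o$ is the subclass of those containing the origin. The support function of a nonempty closed (not necessarily bounded) convex set $K$ is $h_K(x)=\sup\{x\cdot y:y\in K\}\in\mathbb{R}\cup\{\infty\}$. Projection covariant: $(K*L)|S=(K|S)*(L|S)$ for all $K,L\in\mathcal{C}$ and every linear subspace $S$ of $\mathbb{R}^n$ of dimension $k$, $1\le k\le n-1$, where $X|S$ is the orthogonal projection of $X$ onto $S$ (as a subset of $\mathbb{R}^n$). *)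

theory Defs
  imports "HOL-Analysis.Analysis"
begin

definition convex_bodies :: "(real ^ 'n) set set" where
  "convex_bodies = {K. K \<noteq> {} \<and> compact K \<and> convex K}"

definition convex_bodies_origin :: "(real ^ 'n) set set" where
  "convex_bodies_origin = {K \<in> convex_bodies. 0 \<in> K}"

definition support_function :: "(real ^ 'n) set \<Rightarrow> real ^ 'n \<Rightarrow> ereal" where
  "support_function K x = (SUP y\<in>K. ereal (x \<bullet> y))"

text \<open>For nonempty \<open>K\<close> the value is never \<open>-\<infinity>\<close>; for nonempty compact \<open>K\<close> it is finite, so
  that \<open>real_of_ereal\<close> loses nothing on convex bodies.\<close>

lemma ereal_real_support_function:
  assumes "K \<in> convex_bodies"
  shows "ereal (real_of_ereal (support_function K x)) = support_function K x"
proof -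
  have K: "K \<noteq> {}" "compact K"
    using assms by (auto simp: convex_bodies_def)
  have "continuous_on K (\<lambda>y. x \<bullet> y)"
    by (intro continuous_intros)
  then obtain y where y: "y \<in> K" "\<And>z. z \<in> K \<Longrightarrow> x \<bullet> z \<le> x \<bullet> y"
    using continuous_attains_sup[OF K(2,1)] by blast
  have "support_function K x = ereal (x \<bullet> y)"
    unfolding support_function_def
    by (rule antisym) (auto intro!: SUP_least SUP_upper y)
  then show ?thesis by simp
qed

text \<open>The orthogonal projection of \<open>X\<close> onto the linear subspace \<open>S\<close>: the foot of \<open>x\<close> is the
  unique \<open>y \<in> S\<close> with \<open>x - y\<close> orthogonal to \<open>S\<close>.\<close>

definition proj_onto :: "(real ^ 'n) set \<Rightarrow> (real ^ 'n) set \<Rightarrow> (real ^ 'n) set" where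
  "proj_onto S X = {y \<in> S. \<exists>x\<in>X. x - y \<in> S\<^sup>\<bottom>}"

definition projection_covariant ::
  "(real ^ 'n) set set \<Rightarrow> ((real ^ 'n) set \<Rightarrow> (real ^ 'n) set \<Rightarrow> (real ^ 'n) set) \<Rightarrow> bool" where
  "projection_covariant C f \<longleftrightarrow>
     (\<forall>K\<in>C. \<forall>L\<in>C. \<forall>S. subspace S \<and> 1 \<le> dim S \<and> dim S \<le> CARD('n) - 1 \<longrightarrow>
        proj_onto S (f K L) = f (proj_onto S K) (proj_onto S L))"

end

theory Submission
  imports Defs
begin

text \<open>Projecting onto a line \<open>span {u}\<close> shows that \<open>h\<^bsub>K*L\<^esub>(u)\<close> depends only on the values of \<open>h\<^sub>K\<close> and
  \<open>h\<^sub>L\<close> at \<open>\<plusminus> u\<close>. For segments \<open>K\<close>, \<open>L\<close> in \<open>span {u}\<close>, \<open>K * L\<close> lies in \<open>span {u}\<close> as well, and comparing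
  with its support function at \<open>u + w\<close>, \<open>w\<close> orthogonal to \<open>u\<close>, shows that this dependence \<open>F\<close> is the same in
  all directions and positively homogeneous. For \<open>u\<close> orthogonal to \<open>v\<close>, rectangles spanned by segments along
  \<open>u\<close> and \<open>v\<close> turn subadditivity of \<open>h\<^bsub>K*L\<^esub>\<close> for \<open>u + v\<close> into subadditivity of \<open>F\<close>, and for
  \<open>v = (u + v) + (- u)\<close> into a lower bound that makes \<open>F\<close> Lipschitz up to the boundary of its cone.
  Separating points from the closed epigraph of \<open>F\<close> then gives \<open>M\<close>. The converse is
  \<open>h\<^bsub>K|S\<^esub>(x) = h\<^sub>K(x|S)\<close>.\<close>

section \<open>Support functions and projections of convex bodies\<close>

text \<open>Real values keep the arithmetic out of \<open>ereal\<close>. On a convex body nothing is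
  lost; an infinite value of an unbounded set becomes 0.\<close>

definition hreal :: "(real ^ 'n) set \<Rightarrow> real ^ 'n \<Rightarrow> real" where
  "hreal K x = real_of_ereal (support_function K x)"

lemma support_function_eq_Max:
  assumes "y \<in> K" "\<And>z. z \<in> K \<Longrightarrow> x \<bullet> z \<le> x \<bullet> y"
  shows "support_function K x = ereal (x \<bullet> y)"
  unfolding support_function_def
  by (rule antisym) (auto intro!: SUP_least SUP_upper assms)

lemma hreal_eqI:
  assumes "y \<in> K" "x \<bullet> y = m" "\<And>z. z \<in> K \<Longrightarrow> x \<bullet> z \<le> m"
  shows "hreal K x = m"
  using support_function_eq_Max[of y K x] assms by (simp add: hreal_def)

lemma ereal_hreal: "K \<in> convex_bodies \<Longrightarrow> ereal (hreal K x) = support_function K x"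
  by (simp add: hreal_def ereal_real_support_function)

lemma hreal_attained:
  assumes "K \<in> convex_bodies"
  obtains y where "y \<in> K" "x \<bullet> y = hreal K x"
proof -
  have K: "K \<noteq> {}" "compact K"
    using assms by (auto simp: convex_bodies_def)
  have "continuous_on K (\<lambda>y. x \<bullet> y)"
    by (intro continuous_intros)
  then obtain y where y: "y \<in> K" "\<And>z. z \<in> K \<Longrightarrow> x \<bullet> z \<le> x \<bullet> y"
    using continuous_attains_sup[OF K(2,1)] by blast
  then have "hreal K x = x \<bullet> y"
    by (intro hreal_eqI) auto
  with y that show thesis by metis
qed

lemma hreal_upper:
  assumes "K \<in> convex_bodies" "y \<in> K"
  shows "x \<bullet> y \<le> hreal K x"
proof -
  have "ereal (x \<bullet> y) \<le> ereal (hreal K x)"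
    using assms by (auto simp: ereal_hreal support_function_def intro: SUP_upper)
  then show ?thesis by simp
qed

lemma hreal_scale:
  assumes "K \<in> convex_bodies" "c \<ge> 0"
  shows "hreal K (c *\<^sub>R x) = c * hreal K x"
proof -
  obtain y where "y \<in> K" "x \<bullet> y = hreal K x"
    using assms(1) by (rule hreal_attained[of K x])
  with assms show ?thesis
    by (intro hreal_eqI[of y]) (auto intro: mult_left_mono hreal_upper)
qed

lemma hreal_subadd:
  assumes "K \<in> convex_bodies"
  shows "hreal K (x + y) \<le> hreal K x + hreal K y"
proof -
  obtain z where "z \<in> K" "(x + y) \<bullet> z = hreal K (x + y)"
    using assms by (rule hreal_attained[of K "x + y"])
  moreover have "x \<bullet> z \<le> hreal K x" "y \<bullet> z \<le> hreal K y"
    using assms \<open>z \<in> K\<close> by (auto intro: hreal_upper)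
  ultimately show ?thesis by (simp add: inner_add_left)
qed

lemma hreal_zero: "K \<in> convex_bodies \<Longrightarrow> hreal K 0 = 0"
  using hreal_scale[of K 0 0] by simp

lemma hreal_antipodal_nonneg: "K \<in> convex_bodies \<Longrightarrow> 0 \<le> hreal K (- x) + hreal K x"
  using hreal_subadd[of K "- x" x] by (simp add: hreal_zero)

text \<open>A point of \<open>K\<close> outside \<open>L\<close> is strictly separated from
  \<open>L\<close> by some normal \<open>a\<close>. Since the separation puts \<open>L\<close> on
  the upper side, the support functions are compared at \<open>- a\<close>.\<close>

lemma subset_if_hreal_le:
  assumes K: "K \<in> convex_bodies" and L: "L \<in> convex_bodies"
    and le: "\<And>x. hreal K x \<le> hreal L x"
  shows "K \<subseteq> L"
proof (rule subsetI, rule ccontr)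
  fix z assume z: "z \<in> K" "z \<notin> L"
  have "convex L" "closed L"
    using L by (auto simp: convex_bodies_def compact_imp_closed)
  then obtain a b where ab: "a \<bullet> z < b" "\<And>x. x \<in> L \<Longrightarrow> a \<bullet> x > b"
    using separating_hyperplane_closed_point[of L z] z(2) by auto
  obtain y where y: "y \<in> L" "(- a) \<bullet> y = hreal L (- a)"
    using L by (rule hreal_attained[of L "- a"])
  have "(- a) \<bullet> z \<le> hreal K (- a)"
    using K z(1) by (rule hreal_upper)
  with ab(1) ab(2)[OF y(1)] y(2) le[of "- a"] show False by simp
qed

lemma convex_body_eqI:
  assumes "K \<in> convex_bodies" "L \<in> convex_bodies" "\<And>x. hreal K x = hreal L x"
  shows "K = L"
  using subset_if_hreal_le[of K L] subset_if_hreal_le[of L K] assms by auto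

lemma hreal_plus:
  assumes K: "K \<in> convex_bodies" and L: "L \<in> convex_bodies"
  shows "hreal (K + L) x = hreal K x + hreal L x"
proof -
  obtain y where "y \<in> K" "x \<bullet> y = hreal K x"
    using K by (rule hreal_attained[of K x])
  moreover obtain y' where "y' \<in> L" "x \<bullet> y' = hreal L x"
    using L by (rule hreal_attained[of L x])
  ultimately show ?thesis
    by (intro hreal_eqI[of "y + y'"]) (auto simp: inner_add_right set_plus_def intro!: add_mono hreal_upper[OF K] hreal_upper[OF L])
qed

lemma convex_bodies_plus:
  assumes "K \<in> convex_bodies" "L \<in> convex_bodies"
  shows "K + L \<in> convex_bodies"
proof -
  have "K + L = {x + y |x y. x \<in> K \<and> y \<in> L}"
    by (auto simp: set_plus_def)
  then show ?thesis
    using assms compact_sums[of K L] convex_set_plus[of K L]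
    by (auto simp: convex_bodies_def set_plus_def)
qed

section \<open>Orthogonal projection onto subspaces\<close>

lemma orthogonal_projection_exists:
  fixes S :: "'a::euclidean_space set"
  assumes "subspace S"
  obtains y where "y \<in> S" "x - y \<in> S\<^sup>\<bottom>"
proof -
  obtain y z where "y \<in> span S" "\<And>w. w \<in> span S \<Longrightarrow> orthogonal z w" "x = y + z"
    by (rule orthogonal_subspace_decomp_exists[of S x]) blast
  with assms that[of y] show thesis
    by (auto simp: orthogonal_comp_def orthogonal_commute[of z] span_base span_eq_iff[THEN iffD2])
qed

lemma orthogonal_projection_unique:
  assumes S: "subspace S" and "y \<in> S" "x - y \<in> S\<^sup>\<bottom>" "z \<in> S" "x - z \<in> S\<^sup>\<bottom>"
  shows "y = z"
proof -
  have "y - z \<in> S"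
    using assms by (auto intro: subspace_diff)
  moreover have "y - z \<in> S\<^sup>\<bottom>"
    using subspace_diff[OF subspace_orthogonal_comp assms(5,3)] by (simp add: algebra_simps)
  ultimately have "orthogonal (y - z) (y - z)"
    by (simp add: orthogonal_comp_def)
  then show ?thesis by (simp add: orthogonal_self)
qed

text \<open>Uniqueness of the foot makes the chosen feet a linear map, so compactness and convexity
  pass to projections by the image theorems.\<close>

lemma proj_onto_eq_linear_image:
  assumes S: "subspace S"
  obtains p where "linear p" "\<And>X. proj_onto S X = p ` X"
    "\<And>x. p x \<in> S" "\<And>x. x - p x \<in> S\<^sup>\<bottom>"
proof -
  obtain p where p: "\<And>x. p x \<in> S" "\<And>x. x - p x \<in> S\<^sup>\<bottom>"
  proof -
    have "\<forall>x. \<exists>y. y \<in> S \<and> x - y \<in> S\<^sup>\<bottom>"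
      using orthogonal_projection_exists[OF S] by blast
    then show thesis
      using that by metis
  qed
  have uniq: "p x = y" if "y \<in> S" "x - y \<in> S\<^sup>\<bottom>" for x y
    using orthogonal_projection_unique[OF S p[of x] that] .
  have "linear p"
  proof (rule linearI)
    fix x y
    have "(x - p x) + (y - p y) \<in> S\<^sup>\<bottom>"
      by (intro subspace_add subspace_orthogonal_comp p)
    then show "p (x + y) = p x + p y"
      by (intro uniq subspace_add S p) (simp add: algebra_simps)
  next
    fix c x
    have "c *\<^sub>R (x - p x) \<in> S\<^sup>\<bottom>"
      by (intro subspace_mul subspace_orthogonal_comp p)
    then show "p (c *\<^sub>R x) = c *\<^sub>R p x"
      by (intro uniq subspace_mul S p) (simp add: algebra_simps)
  qed
  moreover have "proj_onto S X = p ` X" for X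
    using p uniq by (fastforce simp: proj_onto_def)
  ultimately show thesis
    using p that by blast
qed

lemma proj_onto_convex_bodies:
  assumes "subspace S" "K \<in> convex_bodies"
  shows "proj_onto S K \<in> convex_bodies"
proof -
  obtain p where "linear p" "\<And>X. proj_onto S X = p ` X"
    using proj_onto_eq_linear_image[OF assms(1)] by metis
  with assms(2) show ?thesis
    by (auto simp: convex_bodies_def compact_continuous_image linear_continuous_on
        linear_conv_bounded_linear convex_linear_image)
qed

text \<open>Orthogonal projection is self-adjoint: pairing \<open>x\<close> with the foot of
  \<open>z\<close> equals pairing the foot \<open>y\<close> of \<open>x\<close> with
  \<open>z\<close>.\<close>

lemma hreal_proj_onto:
  assumes S: "subspace S" and K: "K \<in> convex_bodies" and y: "y \<in> S" "x - y \<in> S\<^sup>\<bottom>"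
  shows "hreal (proj_onto S K) x = hreal K y"
proof -
  obtain p where p: "\<And>X. proj_onto S X = p ` X" "\<And>z. p z \<in> S" "\<And>z. z - p z \<in> S\<^sup>\<bottom>"
    using proj_onto_eq_linear_image[OF S] by metis
  have inner: "x \<bullet> p z = y \<bullet> z" for z
  proof -
    have "(x - y) \<bullet> p z = 0" "(z - p z) \<bullet> y = 0"
      using y p by (auto simp: orthogonal_comp_def orthogonal_def inner_commute)
    then show ?thesis
      by (simp add: inner_diff_left inner_diff_right inner_commute)
  qed
  obtain z where "z \<in> K" "y \<bullet> z = hreal K y"
    using K by (rule hreal_attained[of K y])
  then show ?thesis
    by (intro hreal_eqI[of "p z"]) (auto simp: p(1) inner intro!: hreal_upper[OF K])
qed

section \<open>Projections onto lines, and segments on them\<close>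

lemma hreal_eq_on_line:
  assumes "K \<in> convex_bodies" "L \<in> convex_bodies"
    and "hreal K x = hreal L x" "hreal K (- x) = hreal L (- x)"
  shows "hreal K (c *\<^sub>R x) = hreal L (c *\<^sub>R x)"
proof (cases "c \<ge> 0")
  case True
  with assms show ?thesis by (simp add: hreal_scale)
next
  case False
  with hreal_scale[of K "- c" "- x"] hreal_scale[of L "- c" "- x"] assms show ?thesis by simp
qed

text \<open>The foot of any direction on the line is a multiple of \<open>x\<close>, and positive
  homogeneity reduces the support value there to the one at \<open>x\<close> or at
  \<open>- x\<close>.\<close>

lemma proj_onto_line_eqI:
  assumes K: "K \<in> convex_bodies" and L: "L \<in> convex_bodies"
    and eq: "hreal K x = hreal L x" "hreal K (- x) = hreal L (- x)"
  shows "proj_onto (span {x}) K = proj_onto (span {x}) L"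
proof (rule convex_body_eqI)
  fix v
  obtain y where y: "y \<in> span {x}" "v - y \<in> (span {x})\<^sup>\<bottom>"
    using orthogonal_projection_exists[OF subspace_span] by blast
  then obtain c where "y = c *\<^sub>R x"
    by (auto simp: span_singleton)
  then have "hreal K y = hreal L y"
    using hreal_eq_on_line[OF K L eq] by simp
  then show "hreal (proj_onto (span {x}) K) v = hreal (proj_onto (span {x}) L) v"
    using hreal_proj_onto[OF subspace_span K y] hreal_proj_onto[OF subspace_span L y] by simp
qed (intro proj_onto_convex_bodies subspace_span K L)+

text \<open>Parametrised so that the support function takes the value \<open>b\<close> at \<open>u\<close> and \<open>a\<close> at \<open>- u\<close>,
  without normalising \<open>u\<close>.\<close>

definition seg :: "real ^ 'n \<Rightarrow> real \<Rightarrow> real \<Rightarrow> (real ^ 'n) set" where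
  "seg u a b = (\<lambda>s. (s / (u \<bullet> u)) *\<^sub>R u) ` {- a..b}"

lemma seg_convex_bodies:
  assumes "0 \<le> a + b"
  shows "seg u a b \<in> convex_bodies"
proof -
  have lin: "linear (\<lambda>s. (s / (u \<bullet> u)) *\<^sub>R u)"
    by (rule linearI) (auto simp: add_divide_distrib algebra_simps)
  have "compact {- a..b}" "convex {- a..b}" "{- a..b} \<noteq> {}"
    using assms by auto
  then show ?thesis
    unfolding convex_bodies_def seg_def
    using compact_continuous_image[OF linear_continuous_on, of _ "{- a..b}"] convex_linear_image[OF lin]
      lin[unfolded linear_conv_bounded_linear] by blast
qed

text \<open>The third assumption says that \<open>c *\<^sub>R u\<close> is the foot of
  \<open>x\<close> on the line. The sign of \<open>c\<close> decides which endpoint is maximal,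
  hence the companion lemma for the other sign.\<close>

lemma hreal_seg_nonneg:
  assumes "0 \<le> a + b" "u \<noteq> 0" "x \<bullet> u = c * (u \<bullet> u)" "0 \<le> c"
  shows "hreal (seg u a b) x = c * b"
proof (rule hreal_eqI)
  show "(b / (u \<bullet> u)) *\<^sub>R u \<in> seg u a b"
    using assms(1) by (auto simp: seg_def)
qed (use assms in \<open>auto simp: seg_def mult.commute intro: mult_right_mono\<close>)

lemma hreal_seg_nonpos:
  assumes "0 \<le> a + b" "u \<noteq> 0" "x \<bullet> u = - c * (u \<bullet> u)" "0 \<le> c"
  shows "hreal (seg u a b) x = c * a"
proof (rule hreal_eqI)
  show "(- a / (u \<bullet> u)) *\<^sub>R u \<in> seg u a b"
    using assms(1) unfolding seg_def by (intro imageI) auto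
next
  fix z assume "z \<in> seg u a b"
  then obtain s where "z = (s / (u \<bullet> u)) *\<^sub>R u" "- a \<le> s"
    unfolding seg_def by fastforce
  with assms show "x \<bullet> z \<le> c * a"
    using mult_left_mono[of "- s" a c] by (simp add: mult.commute)
qed (use assms in auto)

text \<open>Segments on the line are fixed by the projection; with covariance this will force the
  operation on two such segments to stay within the line.\<close>

lemma proj_onto_seg: "proj_onto (span {u}) (seg u a b) = seg u a b"
proof -
  obtain p where p: "\<And>X. proj_onto (span {u}) X = p ` X" "\<And>x. p x \<in> span {u}"
      "\<And>x. x - p x \<in> (span {u})\<^sup>\<bottom>"
    using proj_onto_eq_linear_image[OF subspace_span] by metis
  have "p z = z" if "z \<in> seg u a b" for z
  proof (rule orthogonal_projection_unique[OF subspace_span p(2,3)])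
    show "z \<in> span {u}"
      using that by (auto simp: seg_def span_singleton)
    show "z - z \<in> (span {u})\<^sup>\<bottom>"
      by (simp add: subspace_0 subspace_orthogonal_comp)
  qed
  then show ?thesis by (simp add: p(1))
qed

lemma mem_orthogonal_comp_span_singleton:
  "w \<in> (span {u})\<^sup>\<bottom> \<longleftrightarrow> u \<bullet> w = 0"
  using span_base[of u "{u}"] by (auto simp: orthogonal_comp_def orthogonal_def span_singleton)

lemma hreal_seg:
  assumes "0 \<le> a + b" "u \<noteq> 0"
  shows "hreal (seg u a b) u = b" "hreal (seg u a b) (- u) = a"
  using hreal_seg_nonneg[OF assms, of u 1] hreal_seg_nonpos[OF assms, of "- u" 1] by simp_all

lemma hreal_seg_orthogonal:
  assumes "0 \<le> a + b" "u \<noteq> 0" "x \<bullet> u = 0"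
  shows "hreal (seg u a b) x = 0"
  using hreal_seg_nonneg[OF assms(1,2), of x 0] assms(3) by simp

section \<open>Sublinear functions on closed cones\<close>

text \<open>Continuity on the closed cone \<open>D\<close> makes the epigraph a closed convex cone.
  Separating it from points just below the graph yields linear minorants of \<open>F\<close> that
  come arbitrarily close to \<open>F z\<close>.\<close>

lemma sublinear_eq_support_function:
  fixes F :: "real ^ 'm \<Rightarrow> real"
  assumes D: "closed D" "z0 \<in> D"
    and add: "\<And>x y. x \<in> D \<Longrightarrow> y \<in> D \<Longrightarrow> x + y \<in> D \<and> F (x + y) \<le> F x + F y"
    and scale: "\<And>c x. 0 \<le> c \<Longrightarrow> x \<in> D \<Longrightarrow> c *\<^sub>R x \<in> D \<and> F (c *\<^sub>R x) = c * F x"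
    and cont: "continuous_on D F"
  shows "\<exists>M. M \<noteq> {} \<and> closed M \<and> convex M \<and> (\<forall>z\<in>D. support_function M z = ereal (F z))"
proof -
  define E where "E = {(z, r). z \<in> D \<and> F z \<le> r}"
  have "closed E"
  proof -
    have "continuous_on (D \<times> UNIV) (\<lambda>w. snd w - F (fst w))"
      by (intro continuous_intros continuous_on_compose2[OF cont]) auto
    then have "closed ((D \<times> UNIV) \<inter> (\<lambda>w. snd w - F (fst w)) -` {0..})"
      using D(1) by (intro continuous_closed_preimage closed_Times) auto
    also have "(D \<times> UNIV) \<inter> (\<lambda>w. snd w - F (fst w)) -` {0..} = E"
      by (auto simp: E_def)
    finally show ?thesis .
  qed
  have E_scale: "c *\<^sub>R w \<in> E" if "0 \<le> c" "w \<in> E" for c w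
    using that scale by (auto simp: E_def mult_left_mono)
  have E_add: "v + w \<in> E" if "v \<in> E" "w \<in> E" for v w
    using that add by (fastforce simp: E_def)
  have "convex E"
    by (intro convexI E_add E_scale)
  \<comment> \<open>\<open>M\<close> collects all linear functionals dominated by \<open>F\<close>
    on \<open>D\<close>, so only the lower bound for its support function needs work.\<close>
  define M where "M = (\<Inter>z\<in>D. {y. z \<bullet> y \<le> F z})"
  have approx: "\<exists>y\<in>M. F z - e < z \<bullet> y" if z: "z \<in> D" and e: "e > 0" for z e
  proof -
    have "(z, F z - e) \<notin> E"
      using e by (simp add: E_def)
    then obtain a b where "a \<bullet> (z, F z - e) < b \<and> (\<forall>w\<in>E. a \<bullet> w > b)"
      using separating_hyperplane_closed_point[OF \<open>convex E\<close> \<open>closed E\<close>, of "(z, F z - e)"] by metis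
    then have ab: "a \<bullet> (z, F z - e) < b" "\<And>w. w \<in> E \<Longrightarrow> a \<bullet> w > b"
      by auto
    obtain p q where a: "a = (p, q)" by (cases a)
    have zE: "(z, F z) \<in> E"
      using z by (simp add: E_def)
    \<comment> \<open>The cone \<open>E\<close> contains the origin, where the separating functional
      vanishes.\<close>
    have b0: "b < 0"
      using ab(2)[OF E_scale[of 0, OF _ zE]] by (simp add: a)
    \<comment> \<open>A linear functional bounded below on a cone is nonnegative there: a vector
      with negative value could be rescaled to have value exactly \<open>b\<close>.\<close>
    have nonneg: "0 \<le> a \<bullet> w" if "w \<in> E" for w
    proof (rule ccontr)
      assume neg: "\<not> 0 \<le> a \<bullet> w"
      have "a \<bullet> ((b / (a \<bullet> w)) *\<^sub>R w) > b"
        using b0 neg by (intro ab(2) E_scale that) (simp add: divide_nonpos_neg)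
      with neg show False by simp
    qed
    have "0 \<le> p \<bullet> z + q * F z"
      using nonneg[OF zE] by (simp add: a)
    moreover have "p \<bullet> z + q * (F z - e) < 0"
      using ab(1) b0 by (simp add: a)
    \<comment> \<open>Subtracting the two inequalities shows that the hyperplane is not vertical, so
      it can be normalised to the graph of \<open>y\<close>.\<close>
    ultimately have "q * e > 0"
      by (simp add: algebra_simps)
    then have q: "q > 0"
      using e by (simp add: zero_less_mult_iff)
    define y where "y = (- 1 / q) *\<^sub>R p"
    have "y \<in> M"
    proof -
      have "z' \<bullet> y \<le> F z'" if "z' \<in> D" for z'
      proof -
        have "0 \<le> p \<bullet> z' + q * F z'"
          using nonneg[of "(z', F z')"] that by (simp add: a E_def)
        then show ?thesis
          using q by (simp add: y_def field_simps inner_commute)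
      qed
      then show ?thesis by (simp add: M_def)
    qed
    moreover have "F z - e < z \<bullet> y"
      using \<open>p \<bullet> z + q * (F z - e) < 0\<close> q by (simp add: y_def field_simps inner_commute)
    ultimately show ?thesis by blast
  qed
  show ?thesis
  proof (intro exI[of _ M] conjI ballI)
    show "M \<noteq> {}"
      using approx[OF D(2), of 1] by auto
    show "closed M"
      unfolding M_def by (intro closed_INT ballI closed_halfspace_le)
    show "convex M"
      unfolding M_def by (intro convex_INT convex_halfspace_le)
    fix z assume z: "z \<in> D"
    show "support_function M z = ereal (F z)"
    proof (rule antisym)
      show "support_function M z \<le> ereal (F z)"
        unfolding support_function_def using z by (auto simp: M_def intro!: SUP_least)
      show "ereal (F z) \<le> support_function M z"
      proof (rule ereal_le_epsilon2)
        fix e :: real assume "0 < e"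
        then obtain y where "y \<in> M" "F z - e < z \<bullet> y"
          using approx[OF z] by blast
        then have "ereal (z \<bullet> y) \<le> support_function M z"
          by (auto simp: support_function_def intro: SUP_upper)
        then have "ereal (z \<bullet> y) + ereal e \<le> support_function M z + ereal e"
          by (intro add_right_mono)
        moreover have "ereal (F z) \<le> ereal (z \<bullet> y) + ereal e"
          using \<open>F z - e < z \<bullet> y\<close> by simp
        ultimately show "ereal (F z) \<le> support_function M z + ereal e"
          by (rule order_trans[rotated])
      qed
    qed
  qed
qed

lemma vector_4 [simp]:
  fixes w :: "'a::zero"
  shows "(vector [w, x, y, z] :: 'a ^ 4) $ 1 = w" "(vector [w, x, y, z] :: 'a ^ 4) $ 2 = x"
    "(vector [w, x, y, z] :: 'a ^ 4) $ 3 = y" "(vector [w, x, y, z] :: 'a ^ 4) $ 4 = z"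
  unfolding vector_def by simp_all

section \<open>Projection covariant operations\<close>

text \<open>The pairs \<open>(h\<^sub>K(- x), h\<^sub>K(x))\<close> that occur for \<open>K\<close> in \<open>C\<close>.\<close>

definition admissible :: "(real ^ 'n) set set \<Rightarrow> real \<Rightarrow> real \<Rightarrow> bool" where
  "admissible C a b \<longleftrightarrow> 0 \<le> a + b \<and> (C = convex_bodies_origin \<longrightarrow> 0 \<le> a \<and> 0 \<le> b)"

lemma admissible_sum_nonneg: "admissible C a b \<Longrightarrow> 0 \<le> a + b"
  by (simp add: admissible_def)

lemma admissible_swap: "admissible C a b \<Longrightarrow> admissible C b a"
  by (simp add: admissible_def add.commute)

lemma admissible_nonneg: "0 \<le> a \<Longrightarrow> 0 \<le> b \<Longrightarrow> admissible C a b"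
  by (simp add: admissible_def)

lemma admissible_add: "admissible C a b \<Longrightarrow> admissible C a' b' \<Longrightarrow> admissible C (a + a') (b + b')"
  by (auto simp: admissible_def)

lemma admissible_scale: "0 \<le> k \<Longrightarrow> admissible C a b \<Longrightarrow> admissible C (k * a) (k * b)"
  by (auto simp: admissible_def simp flip: distrib_left)

locale body_class =
  fixes C :: "(real ^ 'n) set set"
  assumes C_cases: "C = convex_bodies \<or> C = convex_bodies_origin"
begin

lemma convex_body: "K \<in> C \<Longrightarrow> K \<in> convex_bodies"
  using C_cases by (auto simp: convex_bodies_origin_def)

lemma plus_in_class: "K \<in> C \<Longrightarrow> L \<in> C \<Longrightarrow> K + L \<in> C"
  using C_cases by (auto simp: convex_bodies_origin_def convex_bodies_plus intro: set_plus_intro[of 0 K 0 L, simplified])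

text \<open>Every admissible pair is realised by a segment of the class, in every direction.\<close>

lemma seg_in_class:
  assumes "admissible C a b"
  shows "seg u a b \<in> C"
proof -
  have body: "seg u a b \<in> convex_bodies"
    using assms by (simp add: admissible_def seg_convex_bodies)
  moreover have "0 \<in> seg u a b" if "C = convex_bodies_origin"
    using assms that image_eqI[of 0 "\<lambda>s. (s / (u \<bullet> u)) *\<^sub>R u" 0 "{- a..b}"]
    by (simp add: admissible_def seg_def)
  ultimately show ?thesis
    using C_cases by (auto simp: convex_bodies_origin_def)
qed

lemma proj_onto_in_class:
  assumes "subspace S" "K \<in> C"
  shows "proj_onto S K \<in> C"
proof -
  have "0 \<in> proj_onto S K" if "0 \<in> K"
    using that assms(1) by (auto simp: proj_onto_def subspace_0 subspace_orthogonal_comp intro!: bexI[of _ 0])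
  then show ?thesis
    using C_cases assms by (auto simp: convex_bodies_origin_def proj_onto_convex_bodies)
qed

lemma admissible_hreal:
  assumes "K \<in> C"
  shows "admissible C (hreal K (- x)) (hreal K x)"
proof -
  have "0 \<le> hreal K y" if "C = convex_bodies_origin" for y
    using assms that hreal_upper[of K 0 y] by (simp add: convex_bodies_origin_def)
  then show ?thesis
    using hreal_antipodal_nonneg[of K x] convex_body[OF assms] by (simp add: admissible_def)
qed

end

locale projection_covariant_operation = body_class C
  for C :: "(real ^ 'n) set set" +
  fixes f :: "(real ^ 'n) set \<Rightarrow> (real ^ 'n) set \<Rightarrow> (real ^ 'n) set"
  assumes card_ge_2: "CARD('n) \<ge> 2"
    and f_body: "\<And>K L. K \<in> C \<Longrightarrow> L \<in> C \<Longrightarrow> f K L \<in> convex_bodies"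
    and covariant: "projection_covariant C f"
begin

lemma proj_onto_line:
  assumes "K \<in> C" "L \<in> C" "u \<noteq> 0"
  shows "proj_onto (span {u}) (f K L) = f (proj_onto (span {u}) K) (proj_onto (span {u}) L)"
proof -
  have "dim (span {u}) = 1"
    using assms(3) by (simp add: dim_singleton)
  with assms covariant card_ge_2 show ?thesis
    unfolding projection_covariant_def by (simp add: subspace_span)
qed

text \<open>Equal values at \<open>u\<close> and \<open>- u\<close> mean equal projections onto
  \<open>span {u}\<close>. By covariance the results then project equally, and the projection keeps
  the support value at \<open>u\<close>.\<close>

lemma hreal_f_cong:
  assumes K: "K \<in> C" "K' \<in> C" and L: "L \<in> C" "L' \<in> C" and u: "u \<noteq> 0"
    and "hreal K u = hreal K' u" "hreal K (- u) = hreal K' (- u)"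
    and "hreal L u = hreal L' u" "hreal L (- u) = hreal L' (- u)"
  shows "hreal (f K L) u = hreal (f K' L') u"
proof -
  have "proj_onto (span {u}) K = proj_onto (span {u}) K'"
       "proj_onto (span {u}) L = proj_onto (span {u}) L'"
    using assms by (simp_all add: proj_onto_line_eqI convex_body)
  then have "proj_onto (span {u}) (f K L) = proj_onto (span {u}) (f K' L')"
    by (simp add: proj_onto_line assms)
  moreover have "u \<in> span {u}" "u - u \<in> (span {u})\<^sup>\<bottom>"
    by (simp_all add: span_base subspace_0 subspace_orthogonal_comp)
  ultimately show ?thesis
    using hreal_proj_onto[OF subspace_span f_body] K L by metis
qed

section \<open>The dependence on four support values in a fixed direction\<close>

text \<open>This is the function F of the overview, still tied to a direction \<open>u\<close>.
  Segments serve as canonical bodies with prescribed values at \<open>- u\<close> and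
  \<open>u\<close>, in this order.\<close>

definition h_along :: "real ^ 'n \<Rightarrow> real \<Rightarrow> real \<Rightarrow> real \<Rightarrow> real \<Rightarrow> real" where
  "h_along u a b c d = hreal (f (seg u a b) (seg u c d)) u"

lemma h_along_eq:
  assumes "K \<in> C" "L \<in> C" "u \<noteq> 0"
  shows "hreal (f K L) u = h_along u (hreal K (- u)) (hreal K u) (hreal L (- u)) (hreal L u)"
  unfolding h_along_def
  using assms admissible_sum_nonneg[OF admissible_hreal, of K u] admissible_sum_nonneg[OF admissible_hreal, of L u]
  by (intro hreal_f_cong seg_in_class) (simp_all add: hreal_seg admissible_hreal)

text \<open>The segments have the same support values at \<open>u + w\<close> as at
  \<open>u\<close>, and likewise for the negatives. Their combination lies in
  \<open>span {u}\<close>, so its support function does not see \<open>w\<close> either.\<close>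

lemma h_along_orthogonal_shift:
  assumes u: "u \<noteq> 0" "u \<bullet> w = 0" and adm: "admissible C a b" "admissible C c d"
  shows "h_along (u + w) a b c d = h_along u a b c d"
proof -
  let ?K = "seg u a b" and ?L = "seg u c d"
  have v: "(u + w) \<bullet> u = 1 * (u \<bullet> u)" "- (u + w) \<bullet> u = - 1 * (u \<bullet> u)"
    using u by (simp_all add: inner_add_left inner_diff_left inner_commute[of w])
  then have nz: "u + w \<noteq> 0"
    using u(1) by auto
  have KL: "?K \<in> C" "?L \<in> C"
    using adm by (auto intro: seg_in_class)
  have "hreal ?K (u + w) = b" "hreal ?K (- (u + w)) = a" "hreal ?L (u + w) = d" "hreal ?L (- (u + w)) = c"
    using hreal_seg_nonneg[OF admissible_sum_nonneg u(1) v(1)]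
      hreal_seg_nonpos[OF admissible_sum_nonneg u(1) v(2)] adm by simp_all
  then have "h_along (u + w) a b c d = hreal (f ?K ?L) (u + w)"
    using h_along_eq[OF KL nz] by simp
  also have "f ?K ?L = proj_onto (span {u}) (f ?K ?L)"
    using proj_onto_line[OF KL u(1)] by (simp add: proj_onto_seg)
  also have "hreal \<dots> (u + w) = hreal (f ?K ?L) u"
    using u(2) by (intro hreal_proj_onto subspace_span f_body KL)
      (auto simp: span_base mem_orthogonal_comp_span_singleton)
  finally show ?thesis by (simp add: h_along_def)
qed

text \<open>Both sides evaluate the same body, built from the segments along \<open>u\<close>, at
  \<open>k *\<^sub>R u\<close>.\<close>

lemma h_along_scale_all:
  assumes u: "u \<noteq> 0" and k: "k > 0" and adm: "admissible C a b" "admissible C c d"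
  shows "h_along (k *\<^sub>R u) (k * a) (k * b) (k * c) (k * d) = k * h_along u a b c d"
proof -
  have KL: "seg u a b \<in> C" "seg u c d \<in> C"
    using adm by (auto intro: seg_in_class)
  have seg: "hreal (seg u p q) (- (k *\<^sub>R u)) = k * p" "hreal (seg u p q) (k *\<^sub>R u) = k * q"
    if "admissible C p q" for p q
    using that u k hreal_seg_nonneg[of p q u "k *\<^sub>R u" k] hreal_seg_nonpos[of p q u "- (k *\<^sub>R u)" k]
    by (simp_all add: admissible_sum_nonneg)
  have "h_along (k *\<^sub>R u) (k * a) (k * b) (k * c) (k * d) = hreal (f (seg u a b) (seg u c d)) (k *\<^sub>R u)"
    using h_along_eq[OF KL, of "k *\<^sub>R u"] u k adm by (simp add: seg)
  then show ?thesis
    using k KL by (simp add: hreal_scale f_body h_along_def)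
qed

text \<open>With \<open>w\<close> orthogonal to \<open>u\<close> and \<open>|w|\<^sup>2 = (k - 1) |u|\<^sup>2\<close>, Thales' circle lets one pass from \<open>u\<close>
  to \<open>k u\<close> by two orthogonal shifts via \<open>u + w\<close>.\<close>

lemma h_along_stretch:
  assumes u: "u \<noteq> 0" and k: "k \<ge> 1" and adm: "admissible C a b" "admissible C c d"
  shows "h_along (k *\<^sub>R u) a b c d = h_along u a b c d"
proof -
  obtain w' where w': "w' \<noteq> 0" "orthogonal u w'"
    using orthogonal_to_vector_exists[of u] card_ge_2 by auto
  define w where "w = (sqrt ((k - 1) * (u \<bullet> u)) / norm w') *\<^sub>R w'"
  have w: "u \<bullet> w = 0" "w \<bullet> w = (k - 1) * (u \<bullet> u)"
    using w' k by (auto simp: w_def orthogonal_def dot_square_norm power2_eq_square)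
  have "u + w \<noteq> 0"
    using u w(1) by (metis add.right_neutral inner_add_right inner_eq_zero_iff inner_zero_right)
  moreover have "(u + w) \<bullet> ((k - 1) *\<^sub>R u - w) = 0"
    using w by (simp add: inner_add_left inner_diff_right inner_commute[of w u])
  ultimately have "h_along ((u + w) + ((k - 1) *\<^sub>R u - w)) a b c d = h_along (u + w) a b c d"
    using adm by (rule h_along_orthogonal_shift)
  then show ?thesis
    using h_along_orthogonal_shift[OF u w(1) adm] by (simp add: algebra_simps)
qed

lemma h_along_rescale:
  assumes u: "u \<noteq> 0" and k: "k > 0" and adm: "admissible C a b" "admissible C c d"
  shows "h_along (k *\<^sub>R u) a b c d = h_along u a b c d"
proof (cases "k \<ge> 1")
  case True
  with assms show ?thesis by (intro h_along_stretch)
next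
  case False
  \<comment> \<open>For \<open>k < 1\<close>, stretching \<open>k *\<^sub>R u\<close> by
    \<open>1 / k\<close> leads back to \<open>u\<close>.\<close>
  with k h_along_stretch[of "k *\<^sub>R u" "1 / k", OF _ _ adm] u show ?thesis by simp
qed

lemma h_along_direction_nonneg:
  assumes u: "u \<noteq> 0" and v: "v \<noteq> 0" and uv: "0 \<le> u \<bullet> v"
    and adm: "admissible C a b" "admissible C c d"
  shows "h_along u a b c d = h_along v a b c d"
proof -
  have pos: "h_along u a b c d = h_along v a b c d" if "u \<noteq> 0" "v \<noteq> 0" "0 < u \<bullet> v" for u v
  proof -
    \<comment> \<open>With this factor \<open>k *\<^sub>R v\<close> has foot \<open>u\<close> on the
      line of \<open>u\<close>, so an orthogonal shift followed by a rescaling leads from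
      \<open>u\<close> to \<open>v\<close>.\<close>
    define k where "k = (u \<bullet> u) / (u \<bullet> v)"
    have k: "k > 0"
      using that by (simp add: k_def)
    have "u \<bullet> (k *\<^sub>R v - u) = 0"
      using that by (simp add: k_def inner_diff_right)
    from h_along_orthogonal_shift[OF that(1) this adm] show ?thesis
      using h_along_rescale[OF that(2) k adm] by simp
  qed
  show ?thesis
  proof (cases "u \<bullet> v = 0")
    case True
    \<comment> \<open>Orthogonal directions are joined through \<open>u + v\<close>, which makes an
      acute angle with both.\<close>
    then have "0 < u \<bullet> (u + v)" "0 < (u + v) \<bullet> v"
      using u v by (simp_all add: inner_add_left inner_add_right)
    moreover from this have "u + v \<noteq> 0" by auto
    ultimately show ?thesis
      using pos[of u "u + v"] pos[of "u + v" v] u v by simp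
  next
    case False
    with uv u v show ?thesis by (intro pos) auto
  qed
qed

text \<open>A direction orthogonal to \<open>u\<close>, signed so as not to point away from
  \<open>v\<close>, is an intermediate stop. This also covers \<open>v\<close> opposite to
  \<open>u\<close>.\<close>

lemma h_along_direction:
  assumes u: "u \<noteq> 0" and v: "v \<noteq> 0" and adm: "admissible C a b" "admissible C c d"
  shows "h_along u a b c d = h_along v a b c d"
proof -
  obtain w' where w': "w' \<noteq> 0" "u \<bullet> w' = 0"
    using orthogonal_to_vector_exists[of u] card_ge_2 by (auto simp: orthogonal_def)
  define w where "w = (if 0 \<le> w' \<bullet> v then w' else - w')"
  have "w \<noteq> 0" "u \<bullet> w = 0" "0 \<le> w \<bullet> v"
    using w' by (auto simp: w_def)
  then show ?thesis
    using h_along_direction_nonneg[of u w, OF _ _ _ adm] h_along_direction_nonneg[of w v, OF _ _ _ adm] u v by simp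
qed

text \<open>Scaling direction and arguments together scales the value, while scaling the direction
  alone changes nothing.\<close>

lemma h_along_homogeneous:
  assumes u: "u \<noteq> 0" and k: "k \<ge> 0" and adm: "admissible C a b" "admissible C c d"
  shows "h_along u (k * a) (k * b) (k * c) (k * d) = k * h_along u a b c d"
proof -
  have pos: "h_along u (k * a) (k * b) (k * c) (k * d) = k * h_along u a b c d"
    if "k > 0" "admissible C a b" "admissible C c d" for k a b c d
    using h_along_scale_all[OF u that] h_along_rescale[OF u that(1), of "k * a" "k * b" "k * c" "k * d"] that
    by (simp add: admissible_scale)
  \<comment> \<open>Homogeneity with factor 2 at the origin gives a number equal to its double,
    which settles \<open>k = 0\<close>.\<close>
  have "h_along u 0 0 0 0 = 0"
    using pos[of 2 0 0 0 0] by (simp add: admissible_nonneg)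
  with pos k adm show ?thesis by (cases "k = 0") auto
qed

section \<open>Sublinearity and Lipschitz bounds from rectangles\<close>

text \<open>The witness is the operation applied to two rectangles. Their support values along
  \<open>u\<close> and \<open>v\<close> can be prescribed independently and add up at
  \<open>u + v\<close>. At \<open>- u\<close> each pair is swapped; direction independence expresses
  all values along \<open>u\<close>.\<close>

lemma box_witness:
  assumes u: "u \<noteq> 0" "v \<noteq> 0" "u \<bullet> v = 0"
    and adm: "admissible C a b" "admissible C c d" "admissible C a' b'" "admissible C c' d'"
  obtains K where "K \<in> convex_bodies"
    "hreal K u = h_along u a b c d" "hreal K (- u) = h_along u b a d c" "hreal K v = h_along u a' b' c' d'"
    "hreal K (u + v) = h_along u (a + a') (b + b') (c + c') (d + d')"
proof -
  define B where "B = (\<lambda>a b a' b'. seg u a b + seg v a' b')"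
  have B: "B p q p' q' \<in> C" "hreal (B p q p' q') u = q" "hreal (B p q p' q') (- u) = p"
    "hreal (B p q p' q') v = q'" "hreal (B p q p' q') (- v) = p'"
    "hreal (B p q p' q') (u + v) = q + q'" "hreal (B p q p' q') (- (u + v)) = p + p'"
    if adm: "admissible C p q" "admissible C p' q'" for p q p' q'
  proof -
    have KL: "seg u p q \<in> C" "seg v p' q' \<in> C"
      using adm by (auto intro: seg_in_class)
    show "B p q p' q' \<in> C"
      unfolding B_def by (intro plus_in_class KL)
    have plus_B: "hreal (B p q p' q') x = hreal (seg u p q) x + hreal (seg v p' q') x" for x
      unfolding B_def by (intro hreal_plus convex_body KL)
    have nn: "0 \<le> p + q" "0 \<le> p' + q'"
      using adm by (auto intro: admissible_sum_nonneg)
    have vu: "v \<bullet> u = 0" using u(3) by (simp add: inner_commute)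
    show "hreal (B p q p' q') u = q" "hreal (B p q p' q') (- u) = p"
      "hreal (B p q p' q') v = q'" "hreal (B p q p' q') (- v) = p'"
      using nn u vu by (simp_all add: plus_B hreal_seg hreal_seg_orthogonal)
    show "hreal (B p q p' q') (u + v) = q + q'"
      using hreal_seg_nonneg[OF nn(1) u(1), of "u + v" 1] hreal_seg_nonneg[OF nn(2) u(2), of "u + v" 1] u(3) vu
      by (simp add: plus_B inner_add_left)
    show "hreal (B p q p' q') (- (u + v)) = p + p'"
      using hreal_seg_nonpos[OF nn(1) u(1), of "- (u + v)" 1] hreal_seg_nonpos[OF nn(2) u(2), of "- (u + v)" 1] u(3) vu
      by (simp add: plus_B inner_add_left inner_diff_left)
  qed
  let ?K = "B a b a' b'" and ?L = "B c d c' d'"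
  have KL: "?K \<in> C" "?L \<in> C"
    using adm by (auto intro: B)
  have uv: "u + v \<noteq> 0"
    using u by (metis add.right_neutral inner_add_right inner_eq_zero_iff inner_zero_right)
  have sums: "admissible C (a + a') (b + b')" "admissible C (c + c') (d + d')"
    using adm by (auto intro: admissible_add)
  show thesis
  proof
    show "f ?K ?L \<in> convex_bodies" using KL by (rule f_body)
    show "hreal (f ?K ?L) u = h_along u a b c d"
      using h_along_eq[OF KL u(1)] adm by (simp add: B)
    show "hreal (f ?K ?L) (- u) = h_along u b a d c"
      using h_along_eq[OF KL, of "- u"] u adm h_along_direction[of "- u" u b a d c]
      by (simp add: B admissible_swap)
    show "hreal (f ?K ?L) v = h_along u a' b' c' d'"
      using h_along_eq[OF KL u(2)] adm h_along_direction[OF u(2,1), of a' b' c' d'] by (simp add: B)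
    show "hreal (f ?K ?L) (u + v) = h_along u (a + a') (b + b') (c + c') (d + d')"
      using h_along_eq[OF KL uv] adm h_along_direction[OF uv u(1) sums]
        B(6,7)[OF adm(1,3)] B(6,7)[OF adm(2,4)] by simp
  qed
qed

lemma h_along_subadditive:
  assumes u: "u \<noteq> 0"
    and adm: "admissible C a b" "admissible C c d" "admissible C a' b'" "admissible C c' d'"
  shows "h_along u (a + a') (b + b') (c + c') (d + d') \<le> h_along u a b c d + h_along u a' b' c' d'"
proof -
  obtain v where v: "v \<noteq> 0" "u \<bullet> v = 0"
    using orthogonal_to_vector_exists[of u] card_ge_2 by (auto simp: orthogonal_def)
  from box_witness[OF u v adm] show ?thesis
    using hreal_subadd by metis
qed

text \<open>Subadditivity of the witness for \<open>v = (u + v) + (- u)\<close>. It bounds the value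
  at a sum from below without requiring negatives of admissible pairs.\<close>

lemma h_along_le_add:
  assumes u: "u \<noteq> 0"
    and adm: "admissible C a b" "admissible C c d" "admissible C a' b'" "admissible C c' d'"
  shows "h_along u a' b' c' d' \<le> h_along u (a + a') (b + b') (c + c') (d + d') + h_along u b a d c"
proof -
  obtain v where v: "v \<noteq> 0" "u \<bullet> v = 0"
    using orthogonal_to_vector_exists[of u] card_ge_2 by (auto simp: orthogonal_def)
  obtain K where K: "K \<in> convex_bodies" "hreal K (- u) = h_along u b a d c" "hreal K v = h_along u a' b' c' d'"
    "hreal K (u + v) = h_along u (a + a') (b + b') (c + c') (d + d')"
    using box_witness[OF u v adm] by metis
  then show ?thesis
    using hreal_subadd[of K "u + v" "- u"] by simp
qed

text \<open>A nonnegative quadruple is a nonnegative combination of the four coordinate vectors,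
  which are admissible for either class; sublinearity does the rest.\<close>

lemma h_along_bound_nonneg:
  assumes u: "u \<noteq> 0"
  obtains B where "B \<ge> 0"
    "\<And>a b c d. 0 \<le> a \<Longrightarrow> 0 \<le> b \<Longrightarrow> 0 \<le> c \<Longrightarrow> 0 \<le> d \<Longrightarrow> h_along u a b c d \<le> B * (a + b + c + d)"
proof -
  define B where "B = \<bar>h_along u 1 0 0 0\<bar> + \<bar>h_along u 0 1 0 0\<bar> + \<bar>h_along u 0 0 1 0\<bar> + \<bar>h_along u 0 0 0 1\<bar>"
  have "h_along u a b c d \<le> B * (a + b + c + d)" if nn: "0 \<le> a" "0 \<le> b" "0 \<le> c" "0 \<le> d" for a b c d
  proof -
    have "h_along u a b c d \<le> h_along u a 0 0 0 + (h_along u 0 b 0 0 + (h_along u 0 0 c 0 + h_along u 0 0 0 d))"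
      using h_along_subadditive[OF u, of a 0 0 0 0 b c d] h_along_subadditive[OF u, of 0 b 0 0 0 0 c d]
        h_along_subadditive[OF u, of 0 0 c 0 0 0 0 d] nn
      by (simp add: admissible_nonneg)
    also have "\<dots> = a * h_along u 1 0 0 0 + (b * h_along u 0 1 0 0 + (c * h_along u 0 0 1 0 + d * h_along u 0 0 0 1))"
      using h_along_homogeneous[OF u nn(1), of 1 0 0 0] h_along_homogeneous[OF u nn(2), of 0 1 0 0]
        h_along_homogeneous[OF u nn(3), of 0 0 1 0] h_along_homogeneous[OF u nn(4), of 0 0 0 1]
      by (simp add: admissible_nonneg)
    also have "\<dots> \<le> a * B + (b * B + (c * B + d * B))"
      using nn by (intro add_mono mult_left_mono) (auto simp: B_def)
    finally show ?thesis by (simp add: algebra_simps)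
  qed
  moreover have "B \<ge> 0" by (simp add: B_def)
  ultimately show thesis using that by blast
qed

text \<open>The difference of two quadruples may fail to be admissible, but adding \<open>r\<close>
  to each coordinate puts it in [0, 2r]. \<open>h_along_le_add\<close> pays for the shift with at
  most 4Br, and subadditivity with at most 8Br for the shifted difference.\<close>

lemma h_along_lipschitz:
  assumes u: "u \<noteq> 0"
  obtains B where "B \<ge> 0"
    "\<And>a b c d a' b' c' d' r. \<lbrakk>admissible C a b; admissible C c d; admissible C a' b'; admissible C c' d';
      \<bar>a - a'\<bar> \<le> r; \<bar>b - b'\<bar> \<le> r; \<bar>c - c'\<bar> \<le> r; \<bar>d - d'\<bar> \<le> r\<rbrakk>
      \<Longrightarrow> \<bar>h_along u a b c d - h_along u a' b' c' d'\<bar> \<le> B * r"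
proof -
  obtain B where B: "B \<ge> 0"
    "\<And>a b c d. 0 \<le> a \<Longrightarrow> 0 \<le> b \<Longrightarrow> 0 \<le> c \<Longrightarrow> 0 \<le> d \<Longrightarrow> h_along u a b c d \<le> B * (a + b + c + d)"
    using h_along_bound_nonneg[OF u] by metis
  have le: "h_along u a b c d - h_along u a' b' c' d' \<le> 12 * B * r"
    if adm: "admissible C a b" "admissible C c d" "admissible C a' b'" "admissible C c' d'"
      and r: "\<bar>a - a'\<bar> \<le> r" "\<bar>b - b'\<bar> \<le> r" "\<bar>c - c'\<bar> \<le> r" "\<bar>d - d'\<bar> \<le> r"
    for a b c d a' b' c' d' r
  proof -
    have r0: "0 \<le> r" using r(1) by linarith
    have adm': "admissible C r r" "admissible C (r + a - a') (r + b - b')" "admissible C (r + c - c') (r + d - d')"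
      using r0 r by (auto intro!: admissible_nonneg)
    have "h_along u a b c d \<le> h_along u (r + a) (r + b) (r + c) (r + d) + h_along u r r r r"
      by (intro h_along_le_add u adm adm')
    moreover have "h_along u (r + a) (r + b) (r + c) (r + d)
        \<le> h_along u (r + a - a') (r + b - b') (r + c - c') (r + d - d') + h_along u a' b' c' d'"
      using h_along_subadditive[OF u adm'(2,3) adm(3,4)] by simp
    moreover have "h_along u r r r r \<le> B * (r + r + r + r)"
      by (intro B r0)
    moreover have "h_along u (r + a - a') (r + b - b') (r + c - c') (r + d - d')
        \<le> B * ((r + a - a') + (r + b - b') + (r + c - c') + (r + d - d'))"
      using r by (intro B) auto
    moreover have "\<dots> \<le> B * (8 * r)"
      using r by (intro mult_left_mono B(1)) linarith
    ultimately show ?thesis by (simp add: algebra_simps)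
  qed
  show thesis
  proof (rule that[of "12 * B"])
    show "12 * B \<ge> 0" using B(1) by simp
  next
    fix a b c d a' b' c' d' r
    assume H: "admissible C a b" "admissible C c d" "admissible C a' b'" "admissible C c' d'"
      "\<bar>a - a'\<bar> \<le> r" "\<bar>b - b'\<bar> \<le> r" "\<bar>c - c'\<bar> \<le> r" "\<bar>d - d'\<bar> \<le> r"
    show "\<bar>h_along u a b c d - h_along u a' b' c' d'\<bar> \<le> 12 * B * r"
      using le[OF H] le[OF H(3,4,1,2)] H(5-8) by (simp add: abs_minus_commute abs_le_iff)
  qed
qed

lemma representation:
  obtains M :: "(real ^ 4) set" where "M \<noteq> {}" "closed M" "convex M"
    "\<And>K L x. K \<in> C \<Longrightarrow> L \<in> C \<Longrightarrow>
      support_function (f K L) x = support_function M (vector [hreal K (- x), hreal K x, hreal L (- x), hreal L x])"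
proof -
  obtain u :: "real ^ 'n" where u: "u \<noteq> 0"
    using vector_choose_size[of 1] by fastforce
  define D :: "(real ^ 4) set" where
    "D = {z. admissible C (z $ 1) (z $ 2) \<and> admissible C (z $ 3) (z $ 4)}"
  define F :: "real ^ 4 \<Rightarrow> real" where "F z = h_along u (z $ 1) (z $ 2) (z $ 3) (z $ 4)" for z
  have "closed D"
    unfolding D_def admissible_def
    by (cases "C = convex_bodies_origin")
      (auto intro!: closed_Collect_conj closed_Collect_le continuous_intros)
  moreover have "0 \<in> D"
    by (simp add: D_def admissible_nonneg)
  moreover have "x + y \<in> D \<and> F (x + y) \<le> F x + F y" if "x \<in> D" "y \<in> D" for x y
    using that h_along_subadditive[OF u] by (simp add: D_def F_def admissible_add)
  moreover have "k *\<^sub>R x \<in> D \<and> F (k *\<^sub>R x) = k * F x" if "0 \<le> k" "x \<in> D" for k x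
    using that h_along_homogeneous[OF u] by (simp add: D_def F_def admissible_scale)
  moreover have "continuous_on D F"
  proof -
    obtain B where B: "B \<ge> 0"
      "\<And>a b c d a' b' c' d' r. \<lbrakk>admissible C a b; admissible C c d; admissible C a' b'; admissible C c' d';
        \<bar>a - a'\<bar> \<le> r; \<bar>b - b'\<bar> \<le> r; \<bar>c - c'\<bar> \<le> r; \<bar>d - d'\<bar> \<le> r\<rbrakk>
        \<Longrightarrow> \<bar>h_along u a b c d - h_along u a' b' c' d'\<bar> \<le> B * r"
      using h_along_lipschitz[OF u] by metis
    have "B-lipschitz_on D F"
    proof (rule lipschitz_onI)
      fix x y assume "x \<in> D" "y \<in> D"
      moreover have "\<bar>x $ i - y $ i\<bar> \<le> dist x y" for i
        using component_le_norm_cart[of "x - y" i] by (simp add: dist_norm)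
      ultimately show "dist (F x) (F y) \<le> B * dist x y"
        by (auto simp: D_def F_def dist_real_def intro!: B)
    qed (rule B)
    then show ?thesis by (rule lipschitz_on_continuous_on)
  qed
  ultimately have "\<exists>M. M \<noteq> {} \<and> closed M \<and> convex M \<and> (\<forall>z\<in>D. support_function M z = ereal (F z))"
    by (rule sublinear_eq_support_function)
  then obtain M where M: "M \<noteq> {}" "closed M" "convex M"
    "\<And>z. z \<in> D \<Longrightarrow> support_function M z = ereal (F z)"
    by blast
  have "support_function (f K L) x = support_function M (vector [hreal K (- x), hreal K x, hreal L (- x), hreal L x])"
    if KL: "K \<in> C" "L \<in> C" for K L x
  proof -
    let ?z = "vector [hreal K (- x), hreal K x, hreal L (- x), hreal L x] :: real ^ 4"
    have "?z \<in> D"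
      using KL by (simp add: D_def admissible_hreal)
    then have "support_function M ?z = ereal (F ?z)"
      by (rule M(4))
    moreover have "F ?z = hreal (f K L) x"
    \<comment> \<open>The origin is no direction for \<open>h_along\<close>; there both sides are
      0.\<close>
    proof (cases "x = 0")
      case True
      then show ?thesis
        using h_along_homogeneous[OF u, of 0 0 0 0 0] KL
        by (simp add: F_def hreal_zero convex_body f_body admissible_nonneg)
    next
      case False
      then show ?thesis
        using h_along_eq[OF KL False] h_along_direction[OF u False admissible_hreal admissible_hreal] KL
        by (simp add: F_def)
    qed
    ultimately show ?thesis
      using ereal_hreal[OF f_body[OF KL]] by simp
  qed
  with M that show thesis by blast
qed

end

section \<open>The converse implication\<close>

text \<open>Projecting before or after the operation replaces \<open>x\<close> and
  \<open>- x\<close> by their feet \<open>y\<close> and \<open>- y\<close>, so both sides equal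
  \<open>H\<close> of the same four values.\<close>

lemma (in body_class) projection_covariantI:
  assumes f_body: "\<And>K L. K \<in> C \<Longrightarrow> L \<in> C \<Longrightarrow> f K L \<in> convex_bodies"
    and H: "\<And>K L x. K \<in> C \<Longrightarrow> L \<in> C \<Longrightarrow> hreal (f K L) x = H (hreal K (- x)) (hreal K x) (hreal L (- x)) (hreal L x)"
  shows "projection_covariant C f"
  unfolding projection_covariant_def
proof (intro ballI allI impI)
  fix K L :: "(real ^ 'n) set" and S :: "(real ^ 'n) set"
  assume KL: "K \<in> C" "L \<in> C" and "subspace S \<and> 1 \<le> dim S \<and> dim S \<le> CARD('n) - 1"
  then have S: "subspace S" by blast
  have pKL: "proj_onto S K \<in> C" "proj_onto S L \<in> C"
    using S KL by (auto intro: proj_onto_in_class)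
  show "proj_onto S (f K L) = f (proj_onto S K) (proj_onto S L)"
  proof (rule convex_body_eqI)
    show "proj_onto S (f K L) \<in> convex_bodies" "f (proj_onto S K) (proj_onto S L) \<in> convex_bodies"
      using S KL pKL by (auto intro: proj_onto_convex_bodies f_body)
    fix x
    obtain y where y: "y \<in> S" "x - y \<in> S\<^sup>\<bottom>"
      using orthogonal_projection_exists[OF S] by blast
    have "- x - - y \<in> S\<^sup>\<bottom>"
      using subspace_neg[OF subspace_orthogonal_comp y(2)] by simp
    note proj = hreal_proj_onto[OF S _ y] hreal_proj_onto[OF S _ subspace_neg[OF S y(1)] this]
    show "hreal (proj_onto S (f K L)) x = hreal (f (proj_onto S K) (proj_onto S L)) x"
      using KL pKL by (simp add: H proj convex_body f_body)
  qed
qed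

theorem theorem9p7:
  fixes C :: "(real ^ 'n) set set"
    and f :: "(real ^ 'n) set \<Rightarrow> (real ^ 'n) set \<Rightarrow> (real ^ 'n) set"
  assumes "CARD('n) \<ge> 2"
    and "C = convex_bodies \<or> C = convex_bodies_origin"
    and "\<And>K L. K \<in> C \<Longrightarrow> L \<in> C \<Longrightarrow> f K L \<in> convex_bodies"
  shows "projection_covariant C f \<longleftrightarrow>
    (\<exists>M :: (real ^ 4) set. M \<noteq> {} \<and> closed M \<and> convex M \<and>
      (\<forall>K\<in>C. \<forall>L\<in>C. \<forall>x.
        support_function (f K L) x =
        support_function M
          (vector [real_of_ereal (support_function K (- x)), real_of_ereal (support_function K x),
                   real_of_ereal (support_function L (- x)), real_of_ereal (support_function L x)])))"
proof
  assume "projection_covariant C f"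
  then interpret projection_covariant_operation C f
    using assms by unfold_locales
  obtain M :: "(real ^ 4) set" where "M \<noteq> {}" "closed M" "convex M"
    "\<And>K L x. K \<in> C \<Longrightarrow> L \<in> C \<Longrightarrow>
      support_function (f K L) x = support_function M (vector [hreal K (- x), hreal K x, hreal L (- x), hreal L x])"
    by (rule representation) blast
  then show "\<exists>M :: (real ^ 4) set. M \<noteq> {} \<and> closed M \<and> convex M \<and>
      (\<forall>K\<in>C. \<forall>L\<in>C. \<forall>x.
        support_function (f K L) x =
        support_function M
          (vector [real_of_ereal (support_function K (- x)), real_of_ereal (support_function K x),
                   real_of_ereal (support_function L (- x)), real_of_ereal (support_function L x)]))"
    unfolding hreal_def by blast
next
  interpret body_class C
    using assms by unfold_locales
  assume "\<exists>M :: (real ^ 4) set. M \<noteq> {} \<and> closed M \<and> convex M \<and>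
      (\<forall>K\<in>C. \<forall>L\<in>C. \<forall>x.
        support_function (f K L) x =
        support_function M
          (vector [real_of_ereal (support_function K (- x)), real_of_ereal (support_function K x),
                   real_of_ereal (support_function L (- x)), real_of_ereal (support_function L x)]))"
  then obtain M :: "(real ^ 4) set" where "\<forall>K\<in>C. \<forall>L\<in>C. \<forall>x. support_function (f K L) x =
      support_function M (vector [hreal K (- x), hreal K x, hreal L (- x), hreal L x])"
    unfolding hreal_def by blast
  \<comment> \<open>Applying \<open>real_of_ereal\<close> to both sides of an equality is harmless
    even if \<open>M\<close> is unbounded.\<close>
  then have "hreal (f K L) x = hreal M (vector [hreal K (- x), hreal K x, hreal L (- x), hreal L x])"
    if "K \<in> C" "L \<in> C" for K L x
    using that by (simp add: hreal_def)
  with assms(3) show "projection_covariant C f"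
    by (rule projection_covariantI[where H = "\<lambda>a b c d. hreal M (vector [a, b, c, d])"])
qed

end
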